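(* Let $P$ and $Q$ be LPMLN programs. Then $P$ and $Q$ are p-strongly equivalent if and only if (i) $P$ and $Q$ are semi-strongly equivalent, and (ii) there exist two constants $c$ and $k$ such that for every SE-model $(X,Y)\in\mathrm{SE}(P)$ we have $W(P,(X,Y))=\exp(c+k\alpha)\cdot W(Q,(X,Y))$.
   Context: All programs are finite and ground. A literal is an atom $a$ or its classical negation $\neg a$. An ASP rule $r$ has the form $l_1\vee\cdots\vee l_k\leftarrow l_{k+1},\dots,l_m,\ not\ l_{m+1},\dots,\ not\ l_n$ with literals $l_i$; write $h(r)=\{l_1,\dots,l_k\}$, $b^+(r)=\{l_{k+1},\dots,l_m\}$, $b^-(r)=\{l_{m+1},\dots,l_n\}$. An interpretation is a set of literals not containing both $a$ and $\neg a$ for any atom $a$. $I\models r$ iff ($b^+(r)\subseteq I$ and $b^-(r)\cap I=\emptyset$) implies $h(r)\cap I\neq\emptyset$; $I\models\Pi$ iff $I$ satisfies every rule of $\Pi$. For an ASP program $\Pi$ (finite set of rules) the GL-reduct is $\Pi^I=\{h(r)\leftarrow b^+(r) : r\in\Pi,\ b^-(r)\cap I=\emptyset\}$, and $I$ is a stable model of $\Pi$ iff $I\models\Pi^I$ and no proper subset of $I$ satisfies $\Pi^I$. An LPMLN program $P$ is a finite set of weighted rules $w:r$, where $r$ is an ASP rule and $w$ is either a real number (soft rule) or the symbol $\alpha$ (hard rule); $\overline{P}=\{r : w:r\in P\}$. For an interpretation $I$, $P_I=\{w:r\in P : I\models r\}$; $I$ is a stable model of $P$ iff $I$ is a stable model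 of the ASP program $\overline{P_I}$; $\mathrm{SM}(P)$ is the set of stable models of $P$. The weight degree is $W(P,I)=\exp(\sum_{w:r\in P_I}w)$, understood as a formal expression $\exp(a+b\alpha)$. The probability degree is $Pr(P,I)=\lim_{\alpha\to\infty}W(P,I)/\sum_{I'\in\mathrm{SM}(P)}W(P,I')$ if $I\in\mathrm{SM}(P)$ and $0$ otherwise. $P$ and $Q$ are p-ordinarily equivalent iff $\mathrm{SM}(P)=\mathrm{SM}(Q)$ and $Pr(P,X)=Pr(Q,X)$ for all $X\in\mathrm{SM}(P)$; they are p-strongly equivalent iff $P\cup R$ and $Q\cup R$ are p-ordinarily equivalent for every LPMLN program $R$; they are semi-strongly equivalent iff $\mathrm{SM}(P\cup R)=\mathrm{SM}(Q\cup R)$ for every LPMLN program $R$. An SE-interpretation is a pair $(X,Y)$ of interpretations with $X\subseteq Y$; it is an SE-model of $P$ iff $X\models(\overline{P_Y})^Y$; $\mathrm{SE}(P)$ is the set of SE-models of $P$, and $W(P,(X,Y))=W(P,Y)$.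
   Formalization: Programs are finite multisets of weighted rules and P ∪ R is the multiset sum; with plain set union the "if" direction fails, e.g. P={1:←a}, Q={−1:←not a}, R={1:←a, 1:a}. *)

theory Defs
  imports Complex_Main "HOL-Library.FSet" "HOL-Library.Multiset"
begin

datatype 'a literal = Atom 'a | CNeg 'a

(* Finite sets of literals h(r), b^+(r), b^-(r). The head may be empty (constraints). *)
datatype 'a rule =
  Rule (hd_lits: "'a literal fset") (pos_lits: "'a literal fset") (neg_lits: "'a literal fset")

definition interpretation_set :: "'a literal set \<Rightarrow> bool" where
  "interpretation_set I \<longleftrightarrow> (\<forall>a. \<not> (Atom a \<in> I \<and> CNeg a \<in> I))"

definition sat_rule :: "'a literal set \<Rightarrow> 'a rule \<Rightarrow> bool" where
  "sat_rule I r \<longleftrightarrow>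
     (fset (pos_lits r) \<subseteq> I \<and> fset (neg_lits r) \<inter> I = {} \<longrightarrow> fset (hd_lits r) \<inter> I \<noteq> {})"

definition sat_asp :: "'a literal set \<Rightarrow> 'a rule set \<Rightarrow> bool" where
  "sat_asp I \<Pi> \<longleftrightarrow> (\<forall>r\<in>\<Pi>. sat_rule I r)"

definition gl_reduct :: "'a rule set \<Rightarrow> 'a literal set \<Rightarrow> 'a rule set" where
  "gl_reduct \<Pi> I = {Rule (hd_lits r) (pos_lits r) {||} | r. r \<in> \<Pi> \<and> fset (neg_lits r) \<inter> I = {}}"

definition asp_stable_model :: "'a rule set \<Rightarrow> 'a literal set \<Rightarrow> bool" where
  "asp_stable_model \<Pi> I \<longleftrightarrow>
     interpretation_set I \<and> sat_asp I (gl_reduct \<Pi> I) \<and>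
     (\<forall>J. J \<subset> I \<longrightarrow> \<not> sat_asp J (gl_reduct \<Pi> I))"

(* Hard is the symbol alpha. *)
datatype weight = Soft real | Hard

(* Finite collections of weighted rules are multisets, and the union of two programs is their
   multiset sum +. This gives W(P \<union> R, I) = W(P, I) W(R, I) even when P and R share weighted rules.
   With idempotent set union this fails, and so does the characterization of p-strong equivalence:
   P = {1 : <- a} and Q = {-1 : <- not a} are semi-strongly equivalent and
   W(P, I) = exp 1 * W(Q, I) for all I, but R = {1 : <- a, 1 : a} contains P and not Q, and the
   stable model {} has probability 1/2 in the set union of P and R, and e/(e+1) in that of
   Q and R. *)
type_synonym 'a lpmln = "(weight \<times> 'a rule) multiset"

definition rules_of :: "'a lpmln \<Rightarrow> 'a rule set" where
  "rules_of P = snd ` set_mset P"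

definition sat_part :: "'a lpmln \<Rightarrow> 'a literal set \<Rightarrow> 'a lpmln" where
  "sat_part P I = filter_mset (\<lambda>(w, r). sat_rule I r) P"

definition SM :: "'a lpmln \<Rightarrow> 'a literal set set" where
  "SM P = {I. asp_stable_model (rules_of (sat_part P I)) I}"

fun weight_value :: "weight \<Rightarrow> real \<Rightarrow> real" where
  "weight_value (Soft w) \<alpha> = w"
| "weight_value Hard \<alpha> = \<alpha>"

(* The formal expression exp(a + b alpha) is represented by the function of the real variable
   alpha that it denotes; this function determines a and b. *)
definition W :: "'a lpmln \<Rightarrow> 'a literal set \<Rightarrow> real \<Rightarrow> real" where
  "W P I = (\<lambda>\<alpha>. exp (\<Sum>(w, r)\<in>#sat_part P I. weight_value w \<alpha>))"

definition Pr :: "'a lpmln \<Rightarrow> 'a literal set \<Rightarrow> real" where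
  "Pr P I =
     (if I \<in> SM P then Lim at_top (\<lambda>\<alpha>. W P I \<alpha> / (\<Sum>I'\<in>SM P. W P I' \<alpha>)) else 0)"

definition p_ordinarily_equivalent :: "'a lpmln \<Rightarrow> 'a lpmln \<Rightarrow> bool" where
  "p_ordinarily_equivalent P Q \<longleftrightarrow> SM P = SM Q \<and> (\<forall>X\<in>SM P. Pr P X = Pr Q X)"

definition p_strongly_equivalent :: "'a lpmln \<Rightarrow> 'a lpmln \<Rightarrow> bool" where
  "p_strongly_equivalent P Q \<longleftrightarrow> (\<forall>R. p_ordinarily_equivalent (P + R) (Q + R))"

definition semi_strongly_equivalent :: "'a lpmln \<Rightarrow> 'a lpmln \<Rightarrow> bool" where
  "semi_strongly_equivalent P Q \<longleftrightarrow> (\<forall>R. SM (P + R) = SM (Q + R))"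

definition SE_interpretation :: "'a literal set \<times> 'a literal set \<Rightarrow> bool" where
  "SE_interpretation = (\<lambda>(X, Y). interpretation_set X \<and> interpretation_set Y \<and> X \<subseteq> Y)"

definition SE :: "'a lpmln \<Rightarrow> ('a literal set \<times> 'a literal set) set" where
  "SE P = {(X, Y). SE_interpretation (X, Y) \<and> sat_asp X (gl_reduct (rules_of (sat_part P Y)) Y)}"

definition W_SE :: "'a lpmln \<Rightarrow> 'a literal set \<times> 'a literal set \<Rightarrow> real \<Rightarrow> real" where
  "W_SE P = (\<lambda>(X, Y). W P Y)"

end

theory Submission
  imports Defs
begin

text \<open>
  Since \<^term>\<open>(Y, Y)\<close> is an SE-model of every program for every interpretation \<^term>\<open>Y\<close>,
  condition (ii) says that the weights of \<open>P\<close> and \<open>Q\<close> are proportional on all interpretations, and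
  then the factor cancels in every probability. Conversely, let \<open>L\<close> be the finite set of literals
  of \<open>P\<close> and \<open>Q\<close>. Facts of weight 0 for all of \<open>L\<close> turn every interpretation inside \<open>L\<close> into a
  stable model, and for each \<open>Z \<subseteq> L\<close> a constraint that only \<open>Z\<close> violates, taken with the weight of
  \<open>Z\<close> under \<open>P\<close>, makes all these stable models equally likely in the extended \<open>P\<close>. They are then
  equally likely in the extended \<open>Q\<close>, so there all weights have the same hard and soft parts.
\<close>

definition log_weight :: "'a lpmln \<Rightarrow> 'a literal set \<Rightarrow> real \<Rightarrow> real" where
  "log_weight P I \<alpha> = (\<Sum>(w, r)\<in>#sat_part P I. weight_value w \<alpha>)"

definition rule_lits :: "'a rule \<Rightarrow> 'a literal set" where
  "rule_lits r = fset (hd_lits r) \<union> fset (pos_lits r) \<union> fset (neg_lits r)"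

definition program_lits :: "'a lpmln \<Rightarrow> 'a literal set" where
  "program_lits P = (\<Union>r\<in>rules_of P. rule_lits r)"

definition fact_rule :: "'a literal \<Rightarrow> 'a rule" where
  "fact_rule x = Rule {|x|} {||} {||}"

text \<open>\<open>Abs_fset\<close> is meaningful only on finite sets, hence the assumption
  \<open>finite L\<close> in the facts about this rule.\<close>

definition exclude_rule :: "'a literal set \<Rightarrow> 'a literal set \<Rightarrow> 'a rule" where
  "exclude_rule L Z = Rule {||} (Abs_fset Z) (Abs_fset (L - Z))"

section \<open>Exponents of weights\<close>

lemma W_eq_exp: "W P I \<alpha> = exp (log_weight P I \<alpha>)"
  by (simp add: W_def log_weight_def)

lemma log_weight_empty [simp]: "log_weight {#} I \<alpha> = 0"
  by (simp add: log_weight_def sat_part_def)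

lemma log_weight_union [simp]: "log_weight (P + R) I \<alpha> = log_weight P I \<alpha> + log_weight R I \<alpha>"
  by (simp add: log_weight_def sat_part_def)

lemma log_weight_add_mset [simp]:
  "log_weight (add_mset (w, r) P) I \<alpha> =
     (if sat_rule I r then weight_value w \<alpha> else 0) + log_weight P I \<alpha>"
  by (simp add: log_weight_def sat_part_def)

lemma log_weight_sum:
  "finite S \<Longrightarrow> log_weight (\<Sum>Z\<in>S. f Z) I \<alpha> = (\<Sum>Z\<in>S. log_weight (f Z) I \<alpha>)"
  by (induction S rule: finite_induct) auto

lemma log_weight_replicate [simp]:
  "log_weight (replicate_mset n (w, r)) I \<alpha> =
     (if sat_rule I r then real n * weight_value w \<alpha> else 0)"
  by (induction n) (auto simp: algebra_simps)

lemma log_weight_null: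
  "\<forall>p\<in>#P. fst p = Soft 0 \<Longrightarrow> log_weight P I \<alpha> = 0"
  by (induction P) auto

text \<open>Soft rules contribute to \<open>s\<close>, and \<open>n\<close> counts the satisfied
  hard rules. That \<open>n\<close> is a natural number lets it serve later as the multiplicity of a
  hard rule.\<close>

lemma log_weight_affine: "\<exists>s n. \<forall>\<alpha>. log_weight P I \<alpha> = s + real n * \<alpha>"
proof (induction P)
  case empty
  show ?case by (rule exI[of _ 0], rule exI[of _ 0]) simp
next
  case (add p P)
  then obtain s n where sn: "\<And>\<alpha>. log_weight P I \<alpha> = s + real n * \<alpha>" by blast
  obtain w r where p: "p = (w, r)" by force
  show ?case
  proof (cases "sat_rule I r")
    case False
    then show ?thesis using sn p by auto
  next
    case sat: True
    show ?thesis
    proof (cases w)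
      case (Soft x)
      then show ?thesis using sn p sat by (intro exI[of _ "x + s"] exI[of _ n]) simp
    next
      case Hard
      then show ?thesis using sn p sat
        by (intro exI[of _ s] exI[of _ "Suc n"]) (simp add: algebra_simps)
    qed
  qed
qed

lemma W_union: "W (P + R) I \<alpha> = W P I \<alpha> * W R I \<alpha>"
  by (simp add: W_eq_exp exp_add)

section \<open>Dependence on occurring literals\<close>

lemma sat_rule_restrict:
  assumes "rule_lits r \<subseteq> L"
  shows "sat_rule (I \<inter> L) r \<longleftrightarrow> sat_rule I r"
  using assms unfolding sat_rule_def rule_lits_def by (auto 0 3)

lemma log_weight_restrict:
  assumes "program_lits P \<subseteq> L"
  shows "log_weight P (I \<inter> L) \<alpha> = log_weight P I \<alpha>"
proof -
  have "rule_lits r \<subseteq> L" if "(w, r) \<in># P" for w r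
    using assms that unfolding program_lits_def rules_of_def by force
  then have "sat_part P (I \<inter> L) = sat_part P I"
    unfolding sat_part_def by (intro filter_mset_cong) (auto simp: sat_rule_restrict)
  then show ?thesis
    by (simp add: log_weight_def)
qed

lemma finite_program_lits [simp]: "finite (program_lits P)"
  by (auto simp: program_lits_def rules_of_def rule_lits_def)

lemma program_lits_union [simp]: "program_lits (P + R) = program_lits P \<union> program_lits R"
  by (auto simp: program_lits_def rules_of_def)

section \<open>Stable models\<close>

lemma rules_of_sat_part: "r \<in> rules_of (sat_part P I) \<longleftrightarrow> r \<in> rules_of P \<and> sat_rule I r"
  unfolding rules_of_def sat_part_def by force

text \<open>\<open>sat_part P I\<close> has already discarded every rule that \<open>I\<close>
  violates. Stability of an interpretation thus reduces to minimality.\<close>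

lemma sat_gl_reduct_sat_part: "sat_asp I (gl_reduct (rules_of (sat_part P I)) I)"
  by (auto simp: sat_asp_def gl_reduct_def rules_of_sat_part sat_rule_def)

lemma SE_diagonal: "interpretation_set Y \<Longrightarrow> (Y, Y) \<in> SE P"
  by (simp add: SE_def SE_interpretation_def sat_gl_reduct_sat_part)

lemma SM_interpretation: "I \<in> SM P \<Longrightarrow> interpretation_set I"
  by (simp add: SM_def asp_stable_model_def)

text \<open>Removing from \<open>I\<close> the literals foreign to \<open>P\<close> preserves
  satisfaction of the reduct, so minimality leaves none of them in \<open>I\<close>.\<close>

lemma SM_subset_program_lits:
  assumes "I \<in> SM P"
  shows "I \<subseteq> program_lits P"
proof (rule ccontr)
  let ?G = "gl_reduct (rules_of (sat_part P I)) I" and ?J = "I \<inter> program_lits P"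
  assume "\<not> I \<subseteq> program_lits P"
  then have "?J \<subset> I" by auto
  moreover have "sat_asp ?J ?G"
    unfolding sat_asp_def
  proof
    fix g assume g: "g \<in> ?G"
    have lits: "rule_lits g \<subseteq> program_lits P"
      using g unfolding gl_reduct_def rules_of_sat_part program_lits_def
      by (auto simp: rule_lits_def)
    have "sat_rule I g"
      using g sat_gl_reduct_sat_part[of I P] by (auto simp: sat_asp_def)
    then show "sat_rule ?J g"
      using sat_rule_restrict[OF lits] by simp
  qed
  ultimately show False
    using assms by (auto simp: SM_def asp_stable_model_def)
qed

text \<open>The facts for the elements of \<open>I\<close> survive in the reduct, and a proper
  subset of \<open>I\<close> violates one of them.\<close>

lemma SM_if_facts:
  assumes "interpretation_set I" and facts: "\<And>x. x \<in> I \<Longrightarrow> fact_rule x \<in> rules_of P"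
  shows "I \<in> SM P"
proof -
  let ?G = "gl_reduct (rules_of (sat_part P I)) I"
  have "\<not> sat_asp J ?G" if "J \<subset> I" for J
  proof -
    obtain x where x: "x \<in> I" "x \<notin> J" using \<open>J \<subset> I\<close> by auto
    have "fact_rule x \<in> rules_of (sat_part P I)"
      using x facts unfolding rules_of_sat_part by (simp add: fact_rule_def sat_rule_def)
    then have "fact_rule x \<in> ?G"
      unfolding gl_reduct_def by (force simp: fact_rule_def)
    moreover have "\<not> sat_rule J (fact_rule x)"
      using x by (simp add: fact_rule_def sat_rule_def)
    ultimately show ?thesis by (auto simp: sat_asp_def)
  qed
  then show ?thesis
    using assms(1) by (simp add: SM_def asp_stable_model_def sat_gl_reduct_sat_part)
qed

lemma SM_eq_if_facts:
  assumes "program_lits P \<subseteq> L" and "\<And>x. x \<in> L \<Longrightarrow> fact_rule x \<in> rules_of P"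
  shows "SM P = {I. interpretation_set I \<and> I \<subseteq> L}"
  using assms SM_interpretation SM_subset_program_lits[of _ P] SM_if_facts[of _ P] by blast

section \<open>The equalizing program\<close>

lemma sat_exclude_rule:
  assumes "finite L" "Z \<subseteq> L" "I \<subseteq> L"
  shows "sat_rule I (exclude_rule L Z) \<longleftrightarrow> I \<noteq> Z"
proof -
  have "finite Z" "finite (L - Z)" using assms finite_subset by auto
  then show ?thesis
    using assms by (auto simp: sat_rule_def exclude_rule_def Abs_fset_inverse)
qed

lemma rule_lits_exclude_rule:
  assumes "finite L" "Z \<subseteq> L"
  shows "rule_lits (exclude_rule L Z) \<subseteq> L"
proof -
  have "finite Z" "finite (L - Z)" using assms finite_subset by auto
  then show ?thesis
    using assms by (auto simp: rule_lits_def exclude_rule_def Abs_fset_inverse)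
qed

text \<open>At \<open>I\<close> the constraints of all \<open>Z \<noteq> I\<close> are satisfied and
  contribute the exponents of \<open>P\<close> at these \<open>Z\<close>. The exponent of
  \<open>P\<close> at \<open>I\<close> supplies the missing summand, so the total is the sum over
  all of \<open>Pow L\<close>, whatever \<open>I\<close> is.\<close>

lemma equalizing_program:
  fixes P :: "'a lpmln"
  assumes L: "finite L"
  obtains R C K where "program_lits R \<subseteq> L" and "\<And>x. x \<in> L \<Longrightarrow> fact_rule x \<in> rules_of R"
    and "\<And>I \<alpha>. I \<subseteq> L \<Longrightarrow> log_weight P I \<alpha> + log_weight R I \<alpha> = C + K * \<alpha>"
proof -
  obtain s n where sn: "\<And>I \<alpha>. log_weight P I \<alpha> = s I + real (n I) * \<alpha>"
    using log_weight_affine[of P] by metis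
  \<comment> \<open>A hard rule adds exactly \<alpha> to the exponent, so the slope
    \<open>n Z\<close> is realized by that many copies.\<close>
  define c where "c Z = {#(Soft (s Z), exclude_rule L Z)#}
    + replicate_mset (n Z) (Hard, exclude_rule L Z)" for Z
  define F where "F = image_mset (\<lambda>x. (Soft 0, fact_rule x)) (mset_set L)"
  define R where "R = F + (\<Sum>Z\<in>Pow L. c Z)"
  have rules_R: "rules_of R = fact_rule ` L \<union> exclude_rule L ` Pow L"
  proof -
    have "rules_of F = fact_rule ` L"
      using L by (auto simp: F_def rules_of_def image_image)
    moreover have "rules_of (c Z) = {exclude_rule L Z}" for Z
      by (auto simp: c_def rules_of_def)
    moreover have "rules_of (\<Sum>Z\<in>Pow L. c Z) = (\<Union>Z\<in>Pow L. rules_of (c Z))"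
      using L by (auto simp: rules_of_def set_mset_sum)
    moreover have "rules_of R = rules_of F \<union> rules_of (\<Sum>Z\<in>Pow L. c Z)"
      by (simp add: R_def rules_of_def image_Un)
    ultimately show ?thesis by auto
  qed
  have "log_weight P I \<alpha> + log_weight R I \<alpha> = (\<Sum>Z\<in>Pow L. s Z) + (\<Sum>Z\<in>Pow L. real (n Z)) * \<alpha>"
    if "I \<subseteq> L" for I \<alpha>
  proof -
    have "log_weight F I \<alpha> = 0"
      by (rule log_weight_null) (auto simp: F_def)
    moreover have "log_weight (c Z) I \<alpha> = (if Z = I then 0 else log_weight P Z \<alpha>)"
      if "Z \<in> Pow L" for Z
      using that \<open>I \<subseteq> L\<close> L by (auto simp: c_def sat_exclude_rule sn)
    ultimately have "log_weight R I \<alpha> = (\<Sum>Z\<in>Pow L. if Z = I then 0 else log_weight P Z \<alpha>)"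
      using L by (simp add: R_def log_weight_sum)
    also have "\<dots> = (\<Sum>Z\<in>Pow L - {I}. log_weight P Z \<alpha>)"
      using L by (intro sum.mono_neutral_cong_right) auto
    finally have "log_weight P I \<alpha> + log_weight R I \<alpha> = (\<Sum>Z\<in>Pow L. log_weight P Z \<alpha>)"
      using L \<open>I \<subseteq> L\<close> by (subst sum.remove[of "Pow L" I]) auto
    then show ?thesis
      by (simp add: sn sum.distrib sum_distrib_right)
  qed
  moreover have "program_lits R \<subseteq> L"
    unfolding program_lits_def rules_R using rule_lits_exclude_rule[OF L]
    by (auto simp: fact_rule_def rule_lits_def)
  ultimately show ?thesis
    using rules_R by (intro that[of R "\<Sum>Z\<in>Pow L. s Z" "\<Sum>Z\<in>Pow L. real (n Z)"]) auto
qed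

section \<open>Limits of quotients of exponential sums\<close>

lemma tendsto_exp_affine:
  fixes u v :: real
  assumes "v \<le> 0"
  shows "((\<lambda>\<alpha>. exp (u + v * \<alpha>)) \<longlongrightarrow> (if v = 0 then exp u else 0)) at_top"
proof (cases "v = 0")
  case False
  then have "filterlim (\<lambda>\<alpha>. v * \<alpha>) at_bot at_top"
    using assms by (intro filterlim_tendsto_neg_mult_at_bot[OF tendsto_const] filterlim_ident) auto
  then have "((\<lambda>\<alpha>. exp u * exp (v * \<alpha>)) \<longlongrightarrow> exp u * 0) at_top"
    by (intro tendsto_intros filterlim_compose[OF exp_at_bot])
  then show ?thesis
    using False by (simp add: exp_add)
qed simp

text \<open>Divide numerator and denominator by \<open>exp (M * \<alpha>)\<close> with
  \<open>M\<close> the largest slope: the terms of smaller slope vanish in the limit, and some term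
  of slope \<open>M\<close> keeps the denominator positive.\<close>

lemma tendsto_gibbs:
  fixes u v :: "'b \<Rightarrow> real"
  assumes S: "finite S" and x: "x \<in> S"
  defines "g \<equiv> \<lambda>y. if v y = Max (v ` S) then exp (u y) else 0"
  shows "((\<lambda>\<alpha>. exp (u x + v x * \<alpha>) / (\<Sum>y\<in>S. exp (u y + v y * \<alpha>))) \<longlongrightarrow> g x / (\<Sum>y\<in>S. g y)) at_top"
    and "(\<Sum>y\<in>S. g y) > 0"
proof -
  let ?M = "Max (v ` S)"
  have "?M \<in> v ` S" using S x by (intro Max_in) auto
  then obtain z where "z \<in> S" "v z = ?M" by auto
  then show pos: "(\<Sum>y\<in>S. g y) > 0"
    using S by (intro sum_pos2[of S z]) (auto simp: g_def)
  have lim: "((\<lambda>\<alpha>. exp (u y + (v y - ?M) * \<alpha>)) \<longlongrightarrow> g y) at_top" if "y \<in> S" for y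
    using tendsto_exp_affine[of "v y - ?M" "u y"] S that by (simp add: g_def)
  have "((\<lambda>\<alpha>. exp (u x + (v x - ?M) * \<alpha>) / (\<Sum>y\<in>S. exp (u y + (v y - ?M) * \<alpha>)))
      \<longlongrightarrow> g x / (\<Sum>y\<in>S. g y)) at_top"
    using pos x by (intro tendsto_divide tendsto_sum lim) auto
  moreover have "exp (u x + (v x - ?M) * \<alpha>) / (\<Sum>y\<in>S. exp (u y + (v y - ?M) * \<alpha>))
      = exp (u x + v x * \<alpha>) / (\<Sum>y\<in>S. exp (u y + v y * \<alpha>))" for \<alpha>
  proof -
    have "exp (u y + (v y - ?M) * \<alpha>) = exp (- ?M * \<alpha>) * exp (u y + v y * \<alpha>)" for y
      by (simp add: exp_add [symmetric] algebra_simps)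
    then show ?thesis by (simp add: sum_distrib_left [symmetric])
  qed
  ultimately show "((\<lambda>\<alpha>. exp (u x + v x * \<alpha>) / (\<Sum>y\<in>S. exp (u y + v y * \<alpha>)))
      \<longlongrightarrow> g x / (\<Sum>y\<in>S. g y)) at_top"
    by simp
qed

text \<open>A nonzero limit forces the largest slope at every point of \<open>S\<close>; equality of
  the limits then forces equal constant terms.\<close>

lemma uniform_gibbs_limit:
  fixes u v :: "'b \<Rightarrow> real"
  assumes S: "finite S" and c: "c \<noteq> 0"
    and lim: "\<And>x. x \<in> S \<Longrightarrow>
      Lim at_top (\<lambda>\<alpha>. exp (u x + v x * \<alpha>) / (\<Sum>y\<in>S. exp (u y + v y * \<alpha>))) = c"
  obtains a b where "\<And>x. x \<in> S \<Longrightarrow> u x = a \<and> v x = b"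
proof -
  define g where "g y = (if v y = Max (v ` S) then exp (u y) else 0)" for y
  have "v x = Max (v ` S) \<and> u x = ln (c * (\<Sum>y\<in>S. g y))" if "x \<in> S" for x
  proof -
    \<comment> \<open>\<open>Lim\<close> is a definite description, so its value is known only
      through a proof of convergence.\<close>
    have "g x / (\<Sum>y\<in>S. g y) = c"
      using tendsto_Lim[OF _ tendsto_gibbs(1)[OF S that, of u v]] lim[OF that]
      by (simp add: g_def)
    moreover have "(\<Sum>y\<in>S. g y) > 0"
      using tendsto_gibbs(2)[OF S that, of v u] by (simp add: g_def)
    ultimately have "g x = c * (\<Sum>y\<in>S. g y)" "g x \<noteq> 0"
      using c by (auto simp: field_simps)
    then show ?thesis
      by (metis g_def ln_exp)
  qed
  then show ?thesis using that by blast
qed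

section \<open>Probabilities and proportional weights\<close>

lemma Pr_eq_log_weight:
  "I \<in> SM P \<Longrightarrow> Pr P I = Lim at_top
     (\<lambda>\<alpha>. exp (log_weight P I \<alpha>) / (\<Sum>J\<in>SM P. exp (log_weight P J \<alpha>)))"
  by (simp add: Pr_def W_eq_exp)

text \<open>The factor cancels for each \<alpha>, so both \<open>Lim\<close> terms are applied to
  the same function.\<close>

lemma proportional_imp_Pr_eq:
  assumes SM: "SM P = SM Q"
    and W: "\<And>I \<alpha>. I \<in> SM P \<Longrightarrow> W P I \<alpha> = f \<alpha> * W Q I \<alpha>" and f: "\<And>\<alpha>. f \<alpha> \<noteq> 0"
  shows "Pr P I = Pr Q I"
proof (cases "I \<in> SM P")
  case True
  have "(\<Sum>J\<in>SM P. W P J \<alpha>) = f \<alpha> * (\<Sum>J\<in>SM P. W Q J \<alpha>)" for \<alpha>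
    by (simp add: W sum_distrib_left)
  then show ?thesis
    using True f by (simp add: Pr_def W SM [symmetric])
qed (simp add: Pr_def SM)

lemma p_strongly_equivalent_imp_proportional:
  assumes PQ: "p_strongly_equivalent P Q"
  obtains c k where "\<And>I \<alpha>. interpretation_set I \<Longrightarrow> W P I \<alpha> = exp (c + k * \<alpha>) * W Q I \<alpha>"
proof -
  define L where "L = program_lits P \<union> program_lits Q"
  have "finite L" by (simp add: L_def)
  obtain R C K where R: "program_lits R \<subseteq> L" "\<And>x. x \<in> L \<Longrightarrow> fact_rule x \<in> rules_of R"
    and PR: "\<And>I \<alpha>. I \<subseteq> L \<Longrightarrow> log_weight P I \<alpha> + log_weight R I \<alpha> = C + K * \<alpha>"
    using equalizing_program[OF \<open>finite L\<close>, of P] by blast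
  define S where "S = {I. interpretation_set I \<and> I \<subseteq> L}"
  have S: "finite S" "{} \<in> S"
    using \<open>finite L\<close> by (auto simp: S_def interpretation_set_def)
  have SM: "SM (P + R) = S" "SM (Q + R) = S"
    unfolding S_def using R by (auto intro!: SM_eq_if_facts simp: L_def rules_of_def image_Un)
  obtain u n where un: "\<And>I \<alpha>. log_weight (Q + R) I \<alpha> = u I + real (n I) * \<alpha>"
    using log_weight_affine[of "Q + R"] by metis
  have "Lim at_top (\<lambda>\<alpha>. exp (u I + real (n I) * \<alpha>) / (\<Sum>J\<in>S. exp (u J + real (n J) * \<alpha>)))
      = 1 / real (card S)" if "I \<in> S" for I
  proof -
    have "Pr (P + R) I = Lim at_top (\<lambda>\<alpha>. exp (C + K * \<alpha>) / (\<Sum>J\<in>S. exp (C + K * \<alpha>)))"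
      using that by (simp add: Pr_eq_log_weight SM PR S_def)
    also have "\<dots> = 1 / real (card S)"
      using S by (simp add: tendsto_Lim)
    finally have "Pr (P + R) I = 1 / real (card S)" .
    moreover have "Pr (P + R) I = Pr (Q + R) I"
      using PQ that SM unfolding p_strongly_equivalent_def p_ordinarily_equivalent_def by metis
    ultimately show ?thesis
      using that by (simp add: Pr_eq_log_weight SM un del: log_weight_union)
  qed
  \<comment> \<open>The empty set lies in \<open>S\<close>, so this is not the default value 0 of a
    division by zero.\<close>
  moreover have "1 / real (card S) \<noteq> 0" using S by auto
  ultimately obtain a b where ab: "\<And>I. I \<in> S \<Longrightarrow> u I = a \<and> real (n I) = b"
    using uniform_gibbs_limit[OF S(1), of _ u "\<lambda>I. real (n I)"] by blast
  \<comment> \<open>On \<open>S\<close> the exponents of \<open>P + R\<close> and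
    \<open>Q + R\<close> are \<open>C + K * \<alpha>\<close> and \<open>a + b * \<alpha>\<close>;
    subtracting cancels \<open>R\<close>. An \<open>I\<close> with literals outside \<open>L\<close>
    is first cut down to \<open>I \<inter> L\<close>, which changes no weight of \<open>P\<close> or
    \<open>Q\<close>.\<close>
  have "W P I \<alpha> = exp ((C - a) + (K - b) * \<alpha>) * W Q I \<alpha>" if "interpretation_set I" for I \<alpha>
  proof -
    have I: "I \<inter> L \<in> S" using that by (auto simp: S_def interpretation_set_def)
    have "log_weight Q (I \<inter> L) \<alpha> + log_weight R (I \<inter> L) \<alpha> = a + b * \<alpha>"
      using un[of "I \<inter> L" \<alpha>] ab[OF I] by simp
    then have "log_weight P (I \<inter> L) \<alpha> = (C - a) + (K - b) * \<alpha> + log_weight Q (I \<inter> L) \<alpha>"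
      using PR[of "I \<inter> L" \<alpha>] by (simp add: algebra_simps)
    moreover have "program_lits P \<subseteq> L" "program_lits Q \<subseteq> L" by (auto simp: L_def)
    ultimately show ?thesis
      by (simp add: W_eq_exp log_weight_restrict exp_add)
  qed
  then show ?thesis by (rule that)
qed

theorem theorem3p23:
  fixes P Q :: "'a lpmln"
  shows "p_strongly_equivalent P Q \<longleftrightarrow>
    semi_strongly_equivalent P Q \<and>
    (\<exists>c k :: real. \<forall>(X, Y)\<in>SE P. W_SE P (X, Y) = (\<lambda>\<alpha>. exp (c + k * \<alpha>) * W_SE Q (X, Y) \<alpha>))"
    (is "_ \<longleftrightarrow> _ \<and> (\<exists>c k. ?prop c k)")
proof (intro iffI conjI)
  assume PQ: "p_strongly_equivalent P Q"
  then show "semi_strongly_equivalent P Q"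
    by (simp add: p_strongly_equivalent_def p_ordinarily_equivalent_def semi_strongly_equivalent_def)
  obtain c k where "\<And>I \<alpha>. interpretation_set I \<Longrightarrow> W P I \<alpha> = exp (c + k * \<alpha>) * W Q I \<alpha>"
    using p_strongly_equivalent_imp_proportional[OF PQ] by blast
  then have "?prop c k"
    by (auto simp: W_SE_def SE_def SE_interpretation_def)
  then show "\<exists>c k. ?prop c k" by blast
next
  assume rhs: "semi_strongly_equivalent P Q \<and> (\<exists>c k. ?prop c k)"
  then obtain c k where "?prop c k" by blast
  then have weights: "W P I \<alpha> = exp (c + k * \<alpha>) * W Q I \<alpha>" if "interpretation_set I" for I \<alpha>
    using SE_diagonal[OF that, of P] by (auto simp: W_SE_def)
  show "p_strongly_equivalent P Q"
    unfolding p_strongly_equivalent_def p_ordinarily_equivalent_def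
  proof (intro allI conjI ballI)
    fix R
    show SM: "SM (P + R) = SM (Q + R)"
      using rhs by (simp add: semi_strongly_equivalent_def)
    show "Pr (P + R) I = Pr (Q + R) I" for I
      \<comment> \<open>The weight of \<open>R\<close> multiplies both sides, so the factor between
        \<open>P\<close> and \<open>Q\<close> persists for the extended programs.\<close>
      by (rule proportional_imp_Pr_eq[OF SM, where f = "\<lambda>\<alpha>. exp (c + k * \<alpha>)"])
        (auto simp: W_union weights SM_interpretation)
  qed
qed

end
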